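(* Let $k$ be a field, $n\ge 2$, and let $A_1,\ldots,A_n\in k[t]$ be coprime monic polynomials with $1\notin\{A_1,\ldots,A_n\}$, and suppose $\operatorname{char}(k)=0$ or $\operatorname{char}(k)>n$. Let $a_i=\deg A_i$ and let $d$ be a positive integer with $d\ge\min_i a_i$. Identify the space $\mathcal{P}_d$ of polynomials of degree $\le d$ with $k^{d+1}$ via coefficient vectors. Then $$\mathcal{F}_d=\bigcup_{T\in\mathcal{T}_d}(\mathcal{V}_T+B_T).$$ In particular, $\mathcal{F}_d$ is a union of finitely many affine subspaces of $\mathcal{P}_d$.
   Context: $k[t]_{\geq 0}$ denotes the set of monic polynomials in $k[t]$ together with $0$; $\deg 0=-\infty$. $\mathcal{M}_d$ is the set of monic polynomials of degree $d$, and $\mathcal{F}_d\subseteq\mathcal{M}_d$ is the set of monic $F$ of degree $d$ for which $x_1A_1+\cdots+x_nA_n=F$ has a solution with all $x_i\in k[t]_{\geq0}$. $\mathcal{T}_d$ is the set of $n$-tuples $T=(e_1,\ldots,e_n)$ (entries integers or $-\infty$) such that (1) there is a unique index $j$ with $e_j=d-a_j\ge 0$, and (2) for $i\neq j$, either $e_i=-\infty$ or $e_i$ is an integer with $0\le e_i<d-a_i$. For such $T$ let $\mathcal{R}_T=\{i: 0<e_i\le d-a_i\}$ and $\mathcal{S}_T=\{i: e_i=0\}$. If $\mathcal{R}_T=\emptyset$, set $\mathcal{V}_T=\{0\}$ and $B_T=\sum_{i\in\mathcal{S}_T}A_i$. Otherwise let $\mathcal{V}_T$ be the $k$-linear span of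 the polynomials $t^mA_i$ for $i\in\mathcal{R}_T$ and $0\le m\le e_i-1$ (equivalently the column space of the matrix $A_T$ whose columns are the coefficient vectors of these polynomials), and $B_T=\sum_{i\in\mathcal{R}_T}t^{e_i}A_i+\sum_{i\in\mathcal{S}_T}A_i$ (empty sums are $0$). *)

theory Defs
  imports
    Complex_Main
    "HOL-Computational_Algebra.Polynomial"
    "HOL-Library.Extended"
    "HOL-Library.FuncSet"
    "HOL-Library.Set_Algebras"
begin

global_interpretation poly_vs: vector_space "smult :: 'k::field \<Rightarrow> 'k poly \<Rightarrow> 'k poly"
  by unfold_locales (simp_all add: smult_add_right smult_add_left)

definition monic_polys_or_zero :: "'k::field poly set" where
  "monic_polys_or_zero = {p. lead_coeff p = 1 \<or> p = 0}"

text \<open>Collective (not pairwise) coprimality; gcds of polynomials are not available over an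
  arbitrary field type, so this follows the pattern of the library's binary notion.\<close>

definition jointly_coprime :: "nat \<Rightarrow> (nat \<Rightarrow> 'k::field poly) \<Rightarrow> bool" where
  "jointly_coprime n A \<longleftrightarrow> (\<forall>c. (\<forall>i\<in>{1..n}. c dvd A i) \<longrightarrow> is_unit c)"

definition monic_of_degree :: "nat \<Rightarrow> 'k::field poly set" where
  "monic_of_degree d = {p. lead_coeff p = 1 \<and> degree p = d}"

definition representable :: "nat \<Rightarrow> (nat \<Rightarrow> 'k::field poly) \<Rightarrow> nat \<Rightarrow> 'k poly set" where
  "representable n A d = {F \<in> monic_of_degree d.
     \<exists>x. (\<forall>i\<in>{1..n}. x i \<in> monic_polys_or_zero) \<and> (\<Sum>i=1..n. x i * A i) = F}"

text \<open>Tuples with entries in the integers together with \<open>-\<infinity>\<close> are extensional functions on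
  \<open>{1..n}\<close>. The type \<^typ>\<open>int extended\<close> also contains \<open>\<infinity>\<close>, which the two conditions exclude.\<close>

definition degree_tuples ::
    "nat \<Rightarrow> (nat \<Rightarrow> 'k::field poly) \<Rightarrow> nat \<Rightarrow> (nat \<Rightarrow> int extended) set" where
  "degree_tuples n A d = {e \<in> {1..n} \<rightarrow>\<^sub>E UNIV.
     \<exists>j\<in>{1..n}.
       (e j = Fin (int d - int (degree (A j))) \<and> 0 \<le> e j) \<and>
       (\<forall>i\<in>{1..n}. e i = Fin (int d - int (degree (A i))) \<and> 0 \<le> e i \<longrightarrow> i = j) \<and>
       (\<forall>i\<in>{1..n}. i \<noteq> j \<longrightarrow>
          e i = Minf \<or> (0 \<le> e i \<and> e i < Fin (int d - int (degree (A i)))))}"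

definition pos_indices ::
    "nat \<Rightarrow> (nat \<Rightarrow> 'k::field poly) \<Rightarrow> nat \<Rightarrow> (nat \<Rightarrow> int extended) \<Rightarrow> nat set" where
  "pos_indices n A d e =
     {i \<in> {1..n}. 0 < e i \<and> e i \<le> Fin (int d - int (degree (A i)))}"

definition zero_indices :: "nat \<Rightarrow> (nat \<Rightarrow> int extended) \<Rightarrow> nat set" where
  "zero_indices n e = {i \<in> {1..n}. e i = 0}"

text \<open>Only applied to positive finite entries; the values at the infinities are junk.\<close>

primrec exponent :: "int extended \<Rightarrow> nat" where
  "exponent (Fin m) = nat m"
| "exponent Pinf = 0"
| "exponent Minf = 0"

definition direction_space ::
    "nat \<Rightarrow> (nat \<Rightarrow> 'k::field poly) \<Rightarrow> nat \<Rightarrow> (nat \<Rightarrow> int extended) \<Rightarrow> 'k poly set" where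
  "direction_space n A d e =
     (if pos_indices n A d e = {} then {0}
      else poly_vs.span
        {monom 1 m * A i | i m. i \<in> pos_indices n A d e \<and> m < exponent (e i)})"

definition base_point ::
    "nat \<Rightarrow> (nat \<Rightarrow> 'k::field poly) \<Rightarrow> nat \<Rightarrow> (nat \<Rightarrow> int extended) \<Rightarrow> 'k poly" where
  "base_point n A d e =
     (\<Sum>i\<in>pos_indices n A d e. monom 1 (exponent (e i)) * A i) + (\<Sum>i\<in>zero_indices n e. A i)"

definition polys_upto :: "nat \<Rightarrow> 'k::field poly set" where
  "polys_upto d = {p. degree p \<le> d}"

text \<open>The library's \<open>affine\<close> is restricted to real vector spaces. Affine subspaces
  are nonempty here.\<close>

definition affine_subspace_upto :: "nat \<Rightarrow> 'k::field poly set \<Rightarrow> bool" where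
  "affine_subspace_upto d X \<longleftrightarrow>
     (\<exists>W b. poly_vs.subspace W \<and> W \<subseteq> polys_upto d \<and> b \<in> polys_upto d \<and> X = b +o W)"

end

theory Submission
  imports Defs
begin

section \<open>Sums of monic polynomials of prescribed degree\<close>

lemma sum_dominated_by_unique_monic:
  fixes p :: "'i \<Rightarrow> 'k::field poly"
  assumes "finite I" and "j \<in> I" and "lead_coeff (p j) = 1" and "degree (p j) = d" and "d > 0"
    and less: "\<And>i. i \<in> I \<Longrightarrow> i \<noteq> j \<Longrightarrow> degree (p i) < d"
  shows "sum p I \<in> monic_of_degree d"
proof -
  have "degree (sum p (I - {j})) < d"
    using less \<open>d > 0\<close> by (intro degree_sum_less) auto
  moreover have "sum p I = sum p (I - {j}) + p j"
    using assms(1,2) by (simp add: sum.remove add.commute)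
  ultimately show ?thesis
    using assms(3,4) by (auto simp: monic_of_degree_def degree_add_eq_right coeff_eq_0)
qed

text \<open>Leading terms cannot cancel: the top coefficient of a sum of monic polynomials is the number
  of summands of maximal degree, which is nonzero in characteristic \<open>0\<close> or \<open>> card I\<close>. That
  number is then \<open>1\<close>, as the sum is monic.\<close>

lemma unique_dominating_summand:
  fixes p :: "'i \<Rightarrow> 'k::field poly"
  assumes fin: "finite I" and char: "CHAR('k) = 0 \<or> CHAR('k) > card I" and "d > 0"
    and monic: "\<And>i. i \<in> I \<Longrightarrow> p i \<in> monic_polys_or_zero"
    and sum: "sum p I \<in> monic_of_degree d"
  obtains j where "j \<in> I" and "lead_coeff (p j) = 1" and "degree (p j) = d"
    and "\<And>i. i \<in> I \<Longrightarrow> i \<noteq> j \<Longrightarrow> degree (p i) < d"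
proof -
  \<comment> \<open>Zero summands are removed first: since \<open>degree 0 = 0\<close>, they would
    otherwise count among the summands of maximal degree if that maximum were 0.\<close>
  define J where "J = {i \<in> I. p i \<noteq> 0}"
  define D where "D = Max ((\<lambda>i. degree (p i)) ` J)"
  define K where "K = {i \<in> J. degree (p i) = D}"
  have finJ: "finite J" using fin by (simp add: J_def)
  \<comment> \<open>A positive characteristic above \<open>card I\<close> divides no positive m up
    to \<open>card I\<close>. This is used twice: for \<open>card K\<close>, so that the top
    coefficient survives, and for \<open>card K - 1\<close>, so that the top summand is
    unique.\<close>
  have inj: "m = 0" if "(of_nat m :: 'k) = 0" "m \<le> card I" for m
    using that char by (metis dvd_imp_le linorder_not_less neq0_conv of_nat_eq_0_iff_char_dvd
        order.trans dvd_0_left)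
  have sumJ: "sum p I = sum p J"
    using fin by (intro sum.mono_neutral_right) (auto simp: J_def)
  have "sum p I \<noteq> 0" using sum by (auto simp: monic_of_degree_def)
  then have "J \<noteq> {}" using sumJ by auto
  then have "D \<in> (\<lambda>i. degree (p i)) ` J"
    unfolding D_def using finJ by (intro Max_in) auto
  then have "K \<noteq> {}" by (auto simp: K_def)
  have finK: "finite K" using finJ by (simp add: K_def)
  have degJ: "degree (p i) \<le> D" if "i \<in> J" for i
    unfolding D_def using finJ that by auto
  have cardK: "card K \<le> card I"
    using fin by (intro card_mono) (auto simp: K_def J_def)
  have "coeff (sum p I) D = (\<Sum>i\<in>J. coeff (p i) D)"
    by (simp add: sumJ coeff_sum)
  also have "\<dots> = (\<Sum>i\<in>J. if i \<in> K then 1 else 0)"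
  proof (rule sum.cong)
    fix i assume i: "i \<in> J"
    show "coeff (p i) D = (if i \<in> K then 1 else 0)"
    proof (cases "degree (p i) = D")
      case True
      then show ?thesis using i monic[of i] by (auto simp: K_def J_def monic_polys_or_zero_def)
    next
      case False
      then show ?thesis using i degJ[OF i] by (auto simp: K_def coeff_eq_0)
    qed
  qed simp
  also have "\<dots> = of_nat (card K)"
    using finJ by (simp add: sum.If_cases K_def Int_def)
  finally have top: "coeff (sum p I) D = of_nat (card K)" .
  have "card K \<noteq> 0" using \<open>K \<noteq> {}\<close> finK by simp
  then have "coeff (sum p I) D \<noteq> 0" using inj[of "card K"] cardK top by auto
  then have "D \<le> degree (sum p I)" by (rule le_degree)
  moreover have "degree (sum p I) \<le> D"
    unfolding sumJ using finJ degJ by (intro degree_sum_le) auto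
  ultimately have "D = d" using sum by (simp add: monic_of_degree_def)
  \<comment> \<open>Only an equation in the field is known here. Subtracting 1 turns it into a
    vanishing count, which \<open>inj\<close> lifts to the naturals.\<close>
  then have "(of_nat (card K) :: 'k) = 1"
    using top sum unfolding monic_of_degree_def by auto
  then have "(of_nat (card K - 1) :: 'k) = 0" using \<open>card K \<noteq> 0\<close> by (simp add: of_nat_diff)
  then have "card K - 1 = 0" using inj[of "card K - 1"] cardK by simp
  with \<open>card K \<noteq> 0\<close> have "card K = 1" by simp
  then obtain j where K: "K = {j}" by (auto simp: card_1_singleton_iff)
  show thesis
  proof
    show "j \<in> I" "degree (p j) = d" using K \<open>D = d\<close> by (auto simp: K_def J_def)
    show "lead_coeff (p j) = 1"
      using K monic[of j] by (auto simp: K_def J_def monic_polys_or_zero_def)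
    show "degree (p i) < d" if "i \<in> I" "i \<noteq> j" for i
    proof (cases "p i = 0")
      case True
      then show ?thesis using \<open>d > 0\<close> by simp
    next
      case False
      then have "i \<in> J" "i \<notin> K" using that K by (auto simp: J_def)
      then show ?thesis using degJ[of i] \<open>D = d\<close> by (auto simp: K_def)
    qed
  qed
qed

section \<open>Degree tuples\<close>

text \<open>\<open>degree 0 = 0\<close> would confuse the zero polynomial with the constant 1; the
  convention deg 0 = -infinity separates them, as the tuples require.\<close>

definition ext_degree :: "'k::field poly \<Rightarrow> int extended" where
  "ext_degree p = (if p = 0 then Minf else Fin (int (degree p)))"

text \<open>Comparing m + a_i with d avoids integer subtraction and matches the degree of a product
  x_i * A_i with deg x_i = m.\<close>

lemma degree_tuples_iff:
  "e \<in> degree_tuples n A d \<longleftrightarrow> e \<in> {1..n} \<rightarrow>\<^sub>E UNIV \<and>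
     (\<exists>j\<in>{1..n}. (\<exists>m. e j = Fin (int m) \<and> m + degree (A j) = d) \<and>
       (\<forall>i\<in>{1..n}. i \<noteq> j \<longrightarrow> e i = Minf \<or> (\<exists>m. e i = Fin (int m) \<and> m + degree (A i) < d)))"
proof -
  have top: "e i = Fin (int d - int (degree (A i))) \<and> 0 \<le> e i \<longleftrightarrow>
      (\<exists>m. e i = Fin (int m) \<and> m + degree (A i) = d)" for i
    by (cases "e i") (auto simp: zero_extended_def intro!: exI[of _ "d - degree (A i)"])
  have below: "0 \<le> e i \<and> e i < Fin (int d - int (degree (A i))) \<longleftrightarrow>
      (\<exists>m. e i = Fin (int m) \<and> m + degree (A i) < d)" for i
  proof (cases "e i")
    case (Fin z)
    then show ?thesis
      by (auto simp: zero_extended_def intro!: exI[of _ "nat z"])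
  qed (auto simp: zero_extended_def)
  \<comment> \<open>An entry with the top value d - a_i meets neither alternative of condition (2),
    and this forces the index j to be unique.\<close>
  have excl: "e i \<noteq> Minf" "\<not> (\<exists>m. e i = Fin (int m) \<and> m + degree (A i) < d)"
    if "\<exists>m. e i = Fin (int m) \<and> m + degree (A i) = d" for i
    using that by auto
  show ?thesis
    unfolding degree_tuples_def mem_Collect_eq top below using excl by meson
qed

lemma degree_tuples_entry:
  assumes "e \<in> degree_tuples n A d" and "i \<in> {1..n}"
  shows "e i = Minf \<or> (\<exists>m. e i = Fin (int m) \<and> m + degree (A i) \<le> d)"
  using assms unfolding degree_tuples_iff by (metis order.refl less_imp_le)

text \<open>Each entry on {1..n} is -infinity or one of 0, ..., d, and extensionality fixes the
  values elsewhere.\<close>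

lemma finite_degree_tuples: "finite (degree_tuples n A d)"
proof (rule finite_subset)
  show "degree_tuples n A d \<subseteq> {1..n} \<rightarrow>\<^sub>E insert Minf ((\<lambda>m. Fin (int m)) ` {..d})"
  proof
    fix e assume e: "e \<in> degree_tuples n A d"
    then have "e \<in> extensional {1..n}" unfolding degree_tuples_iff PiE_def by blast
    moreover have "e i \<in> insert Minf ((\<lambda>m. Fin (int m)) ` {..d})" if "i \<in> {1..n}" for i
      using degree_tuples_entry[OF e that] by auto
    ultimately show "e \<in> {1..n} \<rightarrow>\<^sub>E insert Minf ((\<lambda>m. Fin (int m)) ` {..d})"
      unfolding PiE_def by blast
  qed
qed (auto intro!: finite_PiE)

text \<open>The A_i are nonzero, so deg (x_i A_i) = deg x_i + a_i for nonzero x_i, and the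
  conditions on a tuple say that exactly one product has degree d while the others stay below. By
  \<open>unique_dominating_summand\<close> this is the only way for the sum to be monic of degree
  d.\<close>

lemma ext_degree_tuple_iff:
  fixes A x :: "nat \<Rightarrow> 'k::field poly"
  assumes A: "\<forall>i\<in>{1..n}. lead_coeff (A i) = 1"
    and char: "CHAR('k) = 0 \<or> CHAR('k) > n" and "d > 0"
    and x: "\<forall>i\<in>{1..n}. x i \<in> monic_polys_or_zero"
  shows "(\<Sum>i=1..n. x i * A i) \<in> monic_of_degree d \<longleftrightarrow>
    restrict (\<lambda>i. ext_degree (x i)) {1..n} \<in> degree_tuples n A d"
proof -
  have A0: "A i \<noteq> 0" if "i \<in> {1..n}" for i using A that
    by (metis leading_coeff_0_iff zero_neq_one)
  have deg: "degree (x i * A i) = degree (x i) + degree (A i)" if "i \<in> {1..n}" "x i \<noteq> 0" for i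
    using A0 that by (simp add: degree_mult_eq)
  have "(\<Sum>i=1..n. x i * A i) \<in> monic_of_degree d \<longleftrightarrow>
    (\<exists>j\<in>{1..n}. lead_coeff (x j * A j) = 1 \<and> degree (x j * A j) = d \<and>
      (\<forall>i\<in>{1..n}. i \<noteq> j \<longrightarrow> degree (x i * A i) < d))"
  proof
    assume sum: "(\<Sum>i=1..n. x i * A i) \<in> monic_of_degree d"
    have "x i * A i \<in> monic_polys_or_zero" if "i \<in> {1..n}" for i
      using x A that by (auto simp: monic_polys_or_zero_def lead_coeff_mult)
    from unique_dominating_summand[OF _ _ \<open>d > 0\<close> this sum] char
    show "\<exists>j\<in>{1..n}. lead_coeff (x j * A j) = 1 \<and> degree (x j * A j) = d \<and>
      (\<forall>i\<in>{1..n}. i \<noteq> j \<longrightarrow> degree (x i * A i) < d)"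
      by (metis card_atLeastAtMost diff_Suc_1 finite_atLeastAtMost)
  next
    assume "\<exists>j\<in>{1..n}. lead_coeff (x j * A j) = 1 \<and> degree (x j * A j) = d \<and>
      (\<forall>i\<in>{1..n}. i \<noteq> j \<longrightarrow> degree (x i * A i) < d)"
    then show "(\<Sum>i=1..n. x i * A i) \<in> monic_of_degree d"
      using \<open>d > 0\<close> by (auto intro: sum_dominated_by_unique_monic)
  qed
  also have "\<dots> \<longleftrightarrow> (\<exists>j\<in>{1..n}. (\<exists>m. ext_degree (x j) = Fin (int m) \<and> m + degree (A j) = d) \<and>
    (\<forall>i\<in>{1..n}. i \<noteq> j \<longrightarrow> ext_degree (x i) = Minf \<or>
       (\<exists>m. ext_degree (x i) = Fin (int m) \<and> m + degree (A i) < d)))"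
  proof (intro bex_cong refl)
    fix j assume j: "j \<in> {1..n}"
    have "lead_coeff (x j * A j) = 1 \<and> degree (x j * A j) = d \<longleftrightarrow>
        (\<exists>m. ext_degree (x j) = Fin (int m) \<and> m + degree (A j) = d)"
      using x A j deg[OF j] by (auto simp: ext_degree_def lead_coeff_mult monic_polys_or_zero_def)
    \<comment> \<open>A zero x_i fits the -infinity alternative because its product has
      \<open>degree\<close> 0, which is below d.\<close>
    moreover have "degree (x i * A i) < d \<longleftrightarrow> ext_degree (x i) = Minf \<or>
       (\<exists>m. ext_degree (x i) = Fin (int m) \<and> m + degree (A i) < d)" if "i \<in> {1..n}" for i
      using deg[OF that] \<open>d > 0\<close> by (auto simp: ext_degree_def)
    ultimately show "lead_coeff (x j * A j) = 1 \<and> degree (x j * A j) = d \<and>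
      (\<forall>i\<in>{1..n}. i \<noteq> j \<longrightarrow> degree (x i * A i) < d) \<longleftrightarrow>
      (\<exists>m. ext_degree (x j) = Fin (int m) \<and> m + degree (A j) = d) \<and>
      (\<forall>i\<in>{1..n}. i \<noteq> j \<longrightarrow> ext_degree (x i) = Minf \<or>
       (\<exists>m. ext_degree (x i) = Fin (int m) \<and> m + degree (A i) < d))"
      by blast
  qed
  also have "\<dots> \<longleftrightarrow> restrict (\<lambda>i. ext_degree (x i)) {1..n} \<in> degree_tuples n A d"
    by (simp add: degree_tuples_iff del: atLeastAtMost_iff One_nat_def cong: bex_cong ball_cong)
  finally show ?thesis .
qed

section \<open>Translates as sums with prescribed degrees\<close>

text \<open>For fixed i, the scalars in front of the t^m A_i are the coefficients of one polynomial
  y_i. Positivity of \<open>N i\<close> keeps y_i = 0 admissible, as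
  \<open>degree 0 = 0\<close>.\<close>

lemma span_monom_mult:
  fixes A :: "'i \<Rightarrow> 'k::field poly"
  assumes "finite I" and pos: "\<And>i. i \<in> I \<Longrightarrow> N i > 0"
  shows "poly_vs.span {monom 1 m * A i | i m. i \<in> I \<and> m < N i} =
    {\<Sum>i\<in>I. y i * A i | y. \<forall>i\<in>I. degree (y i) < N i}" (is "poly_vs.span ?G = ?R")
proof
  show "poly_vs.span ?G \<subseteq> ?R"
  proof (rule poly_vs.span_minimal)
    show "?G \<subseteq> ?R"
    proof
      fix v assume "v \<in> ?G"
      then obtain i m where im: "v = monom 1 m * A i" "i \<in> I" "m < N i" by blast
      have "v = (\<Sum>l\<in>I. (if l = i then monom 1 m else 0) * A l)"
        using im \<open>finite I\<close> by (simp add: if_distrib[of "\<lambda>a. a * _"] cong: if_cong)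
      then show "v \<in> ?R"
        using im pos by (auto simp: degree_monom_eq intro!: exI[of _ "\<lambda>l. if l = i then monom 1 m else 0"])
    qed
    show "poly_vs.subspace ?R"
    proof (rule poly_vs.subspaceI)
      show "0 \<in> ?R" using pos by (auto intro!: exI[of _ "\<lambda>_. 0"])
    next
      fix u v assume "u \<in> ?R" "v \<in> ?R"
      then obtain y z where "u = (\<Sum>i\<in>I. y i * A i)" "\<forall>i\<in>I. degree (y i) < N i"
        "v = (\<Sum>i\<in>I. z i * A i)" "\<forall>i\<in>I. degree (z i) < N i" by blast
      then show "u + v \<in> ?R"
        by (auto intro!: exI[of _ "\<lambda>i. y i + z i"] degree_add_less simp: sum.distrib distrib_right)
    next
      fix c v assume "v \<in> ?R"
      then obtain y where "v = (\<Sum>i\<in>I. y i * A i)" "\<forall>i\<in>I. degree (y i) < N i" by blast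
      then show "smult c v \<in> ?R"
        by (auto intro!: exI[of _ "\<lambda>i. smult c (y i)"] le_less_trans[OF degree_smult_le]
            simp: poly_vs.scale_sum_right)
    qed
  qed
next
  show "?R \<subseteq> poly_vs.span ?G"
  proof clarify
    fix y :: "'i \<Rightarrow> 'k poly"
    assume y: "\<forall>i\<in>I. degree (y i) < N i"
    show "(\<Sum>i\<in>I. y i * A i) \<in> poly_vs.span ?G"
    proof (rule poly_vs.span_sum)
      fix i assume i: "i \<in> I"
      have "y i * A i = (\<Sum>m\<le>degree (y i). monom (coeff (y i) m) m) * A i"
        by (simp add: poly_as_sum_of_monoms)
      also have "\<dots> = (\<Sum>m\<le>degree (y i). smult (coeff (y i) m) (monom 1 m * A i))"
        by (simp add: sum_distrib_right smult_monom flip: mult_smult_left)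
      also have "\<dots> \<in> poly_vs.span ?G"
        using i y by (intro poly_vs.span_sum poly_vs.span_scale poly_vs.span_base) fastforce
      finally show "y i * A i \<in> poly_vs.span ?G" .
    qed
  qed
qed

text \<open>\<open>exponent\<close> sends both 0 and -infinity to 0, and finite entries of a degree
  tuple satisfy e_i + a_i <= d, so the exponent alone decides membership.\<close>

lemma pos_indices_degree_tuple:
  assumes "e \<in> degree_tuples n A d"
  shows "pos_indices n A d e = {i \<in> {1..n}. exponent (e i) > 0}"
  using degree_tuples_entry[OF assms] by (fastforce simp: pos_indices_def zero_extended_def)

lemma direction_space_eq:
  fixes A :: "nat \<Rightarrow> 'k::field poly"
  assumes "e \<in> degree_tuples n A d"
  shows "direction_space n A d e =
    {\<Sum>i\<in>pos_indices n A d e. y i * A i | y. \<forall>i\<in>pos_indices n A d e. degree (y i) < exponent (e i)}"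
proof -
  \<comment> \<open>The two branches of the definition agree: without positive indices there are no
    generators, and the span of the empty set is {0}.\<close>
  have "direction_space n A d e = poly_vs.span
    {monom 1 m * A i | i m. i \<in> pos_indices n A d e \<and> m < exponent (e i)}"
    by (auto simp: direction_space_def)
  also have "\<dots> = {\<Sum>i\<in>pos_indices n A d e. y i * A i | y.
      \<forall>i\<in>pos_indices n A d e. degree (y i) < exponent (e i)}"
    by (rule span_monom_mult) (auto simp: pos_indices_degree_tuple[OF assms])
  finally show ?thesis .
qed

text \<open>Splitting off t^m turns the condition of being monic of degree m into the linear
  condition that describes a direction space. At m = 0 this fails for p = 1, where the difference 0
  has \<open>degree\<close> 0.\<close>

lemma monic_iff_degree_diff_monom_less:
  fixes p :: "'k::field poly"
  assumes "m > 0"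
  shows "lead_coeff p = 1 \<and> degree p = m \<longleftrightarrow> degree (p - monom 1 m) < m"
proof
  assume p: "lead_coeff p = 1 \<and> degree p = m"
  have "degree (p - monom 1 m) \<le> m"
    using p by (intro degree_diff_le) (auto simp: degree_monom_eq)
  moreover have "coeff (p - monom 1 m) m = 0" using p by auto
  \<comment> \<open>If the degree were m, the vanishing coefficient would be the leading one; the
    difference would be 0, of \<open>degree\<close> 0, against m > 0.\<close>
  ultimately show "degree (p - monom 1 m) < m"
    using assms by (metis degree_0 leading_coeff_0_iff order_le_less)
next
  assume less: "degree (p - monom 1 m) < m"
  then have "coeff (p - monom 1 m) m = 0" by (rule coeff_eq_0)
  then have "coeff p m = 1" by simp
  moreover have "degree (monom 1 m + (p - monom 1 m)) = degree (monom (1::'k) m)"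
    using less by (intro degree_add_eq_left) (simp add: degree_monom_eq)
  then have "degree p = m" by (simp add: degree_monom_eq)
  ultimately show "lead_coeff p = 1 \<and> degree p = m" by blast
qed

text \<open>A monic x_i of degree e_i > 0 is t^{e_i} + y_i with y_i free below degree e_i; for e_i =
  0 it must be 1, and for e_i = -infinity it must be 0. The fixed parts add up to
  \<open>base_point\<close>, and the free parts y_i A_i sweep out
  \<open>direction_space\<close>.\<close>

lemma translate_eq_sums_of_ext_degree:
  fixes A :: "nat \<Rightarrow> 'k::field poly"
  assumes e: "e \<in> degree_tuples n A d"
  shows "base_point n A d e +o direction_space n A d e =
    {\<Sum>i=1..n. x i * A i | x. \<forall>i\<in>{1..n}. x i \<in> monic_polys_or_zero \<and> ext_degree (x i) = e i}"
    (is "?L = ?R")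
proof -
  define R S where "R = pos_indices n A d e" and "S = zero_indices n e"
  have R: "R = {i \<in> {1..n}. exponent (e i) > 0}"
    unfolding R_def by (rule pos_indices_degree_tuple[OF e])
  have eR: "e i = Fin (int (exponent (e i)))" if "i \<in> R" for i
    using degree_tuples_entry[OF e, of i] that by (auto simp: R)
  have eS: "e i = Fin 0" if "i \<in> S" for i
    using that by (simp add: S_def zero_indices_def zero_extended_def)
  have eM: "e i = Minf" if "i \<in> {1..n} - R - S" for i
    using degree_tuples_entry[OF e, of i] that
    by (auto simp: R S_def zero_indices_def zero_extended_def)
  have sub: "R \<subseteq> {1..n}" "S \<subseteq> {1..n}" "R \<inter> S = {}"
    by (auto simp: R S_def zero_indices_def zero_extended_def)
  have fin: "finite R" "finite S" using sub finite_subset by blast+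
  have split: "(\<Sum>i=1..n. x i * A i) = (\<Sum>i\<in>R. x i * A i) + (\<Sum>i\<in>S. x i * A i)"
    if "\<And>i. i \<in> {1..n} - R - S \<Longrightarrow> x i = 0" for x
  proof -
    have "(\<Sum>i=1..n. x i * A i) = (\<Sum>i\<in>R \<union> S. x i * A i)"
      using sub that by (intro sum.mono_neutral_right) auto
    then show ?thesis using sub fin by (simp add: sum.union_disjoint)
  qed
  have base: "base_point n A d e = (\<Sum>i\<in>R. monom 1 (exponent (e i)) * A i) + (\<Sum>i\<in>S. A i)"
    by (simp add: base_point_def R_def S_def)
  have dir: "direction_space n A d e =
      {\<Sum>i\<in>R. y i * A i | y. \<forall>i\<in>R. degree (y i) < exponent (e i)}"
    unfolding R_def by (rule direction_space_eq[OF e])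
  show ?thesis
  proof
    show "?L \<subseteq> ?R"
    proof
      fix F assume "F \<in> ?L"
      then obtain y where y: "\<forall>i\<in>R. degree (y i) < exponent (e i)"
        and F: "F = base_point n A d e + (\<Sum>i\<in>R. y i * A i)"
        by (auto simp: dir elt_set_plus_def)
      define x where "x i = (if i \<in> R then monom 1 (exponent (e i)) + y i
        else if i \<in> S then 1 else 0)" for i
      have "F = (\<Sum>i=1..n. x i * A i)"
        using sub by (subst split) (auto simp: x_def F base sum.distrib distrib_right intro!: sum.cong)
      moreover have "x i \<in> monic_polys_or_zero \<and> ext_degree (x i) = e i" if i: "i \<in> {1..n}" for i
      proof -
        consider "i \<in> R" | "i \<in> S" "i \<notin> R" | "i \<in> {1..n} - R - S" using i by blast
        then show ?thesis
        proof cases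
          case 1
          then have "lead_coeff (x i) = 1 \<and> degree (x i) = exponent (e i)"
            using y by (subst monic_iff_degree_diff_monom_less) (auto simp: R x_def)
          then show ?thesis using eR[OF 1] by (auto simp: ext_degree_def monic_polys_or_zero_def)
        qed (auto simp: x_def ext_degree_def monic_polys_or_zero_def eS eM)
      qed
      ultimately show "F \<in> ?R" by blast
    qed
  next
    show "?R \<subseteq> ?L"
    proof clarify
      fix x :: "nat \<Rightarrow> 'k poly"
      assume x: "\<forall>i\<in>{1..n}. x i \<in> monic_polys_or_zero \<and> ext_degree (x i) = e i"
      define y where "y i = x i - monom 1 (exponent (e i))" for i
      have xS: "x i = 1" if "i \<in> S" for i
      proof -
        have "ext_degree (x i) = Fin 0" "x i \<in> monic_polys_or_zero"
          using x eS[OF that] sub that by auto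
        \<comment> \<open>\<open>Fin 0\<close> rules out x_i = 0, which also has
          \<open>degree\<close> 0, so x_i is a monic constant.\<close>
        then have "degree (x i) = 0" "lead_coeff (x i) = 1"
          unfolding ext_degree_def monic_polys_or_zero_def by (auto split: if_splits)
        then show ?thesis by (auto elim!: degree_eq_zeroE)
      qed
      have xM: "x i = 0" if "i \<in> {1..n} - R - S" for i
        using x eM[OF that] that by (auto simp: ext_degree_def split: if_splits)
      have "degree (y i) < exponent (e i)" if i: "i \<in> R" for i
      proof -
        have "ext_degree (x i) = Fin (int (exponent (e i)))" using x sub i eR[OF i] by auto
        then have "lead_coeff (x i) = 1 \<and> degree (x i) = exponent (e i)"
          using x sub i by (auto simp: ext_degree_def monic_polys_or_zero_def split: if_splits)
        then show ?thesis
          using i unfolding y_def by (subst (asm) monic_iff_degree_diff_monom_less) (auto simp: R)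
      qed
      then have "(\<Sum>i\<in>R. y i * A i) \<in> direction_space n A d e" by (auto simp: dir)
      moreover have "(\<Sum>i=1..n. x i * A i) = base_point n A d e + (\<Sum>i\<in>R. y i * A i)"
        using xM by (subst split) (auto simp: base xS y_def left_diff_distrib sum_subtractf)
      ultimately show "(\<Sum>i=1..n. x i * A i) \<in> ?L" by (auto simp: elt_set_plus_def)
    qed
  qed
qed

section \<open>The union of affine subspaces\<close>

text \<open>Representations are sorted by the degrees of the x_i:
  \<open>ext_degree_tuple_iff\<close> decides which degree tuples occur, and
  \<open>translate_eq_sums_of_ext_degree\<close> describes the sums belonging to one tuple.\<close>

lemma representable_eq_Union:
  fixes A :: "nat \<Rightarrow> 'k::field poly"
  assumes A: "\<forall>i\<in>{1..n}. lead_coeff (A i) = 1"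
    and char: "CHAR('k) = 0 \<or> CHAR('k) > n" and "d > 0"
  shows "representable n A d =
    (\<Union>e\<in>degree_tuples n A d. base_point n A d e +o direction_space n A d e)" (is "_ = ?U")
proof
  show "representable n A d \<subseteq> ?U"
  proof
    fix F assume "F \<in> representable n A d"
    then obtain x where x: "\<forall>i\<in>{1..n}. x i \<in> monic_polys_or_zero"
      and F: "F = (\<Sum>i=1..n. x i * A i)" "F \<in> monic_of_degree d"
      by (auto simp: representable_def)
    define e where "e = restrict (\<lambda>i. ext_degree (x i)) {1..n}"
    have e: "e \<in> degree_tuples n A d"
      unfolding e_def using ext_degree_tuple_iff[OF assms x] F by simp
    have "F \<in> base_point n A d e +o direction_space n A d e"
      unfolding translate_eq_sums_of_ext_degree[OF e] using x F by (auto simp: e_def)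
    with e show "F \<in> ?U" by blast
  qed
next
  show "?U \<subseteq> representable n A d"
  proof clarify
    fix F e assume e: "e \<in> degree_tuples n A d"
      and "F \<in> base_point n A d e +o direction_space n A d e"
    then obtain x where x: "\<forall>i\<in>{1..n}. x i \<in> monic_polys_or_zero \<and> ext_degree (x i) = e i"
      and F: "F = (\<Sum>i=1..n. x i * A i)"
      by (auto simp: translate_eq_sums_of_ext_degree[OF e])
    \<comment> \<open>Both sides are \<open>undefined\<close> outside {1..n}, so agreement on {1..n}
      is equality of tuples.\<close>
    have "restrict (\<lambda>i. ext_degree (x i)) {1..n} = e"
      using x e by (auto simp: degree_tuples_iff PiE_def extensional_def fun_eq_iff)
    then show "F \<in> representable n A d"
      using ext_degree_tuple_iff[OF assms, of x] x e F by (auto simp: representable_def)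
  qed
qed

text \<open>Every finite entry satisfies e_i + a_i <= d, which bounds the degree of p * A_i by d
  whenever deg p <= e_i. This covers the elements of the direction space and the summands of the
  base point.\<close>

lemma affine_subspace_upto_translate:
  assumes e: "e \<in> degree_tuples n A d"
  shows "affine_subspace_upto d (base_point n A d e +o direction_space n A d e)"
proof -
  have entry: "exponent (e i) + degree (A i) \<le> d" if "i \<in> {1..n}" "e i \<noteq> Minf" for i
    using degree_tuples_entry[OF e, of i] that by auto
  have le: "degree (p * A i) \<le> d" if "i \<in> {1..n}" "e i \<noteq> Minf" "degree p \<le> exponent (e i)" for i p
    using entry[OF that(1,2)] that(3) degree_mult_le[of p "A i"] by linarith
  have R: "i \<in> {1..n}" "e i \<noteq> Minf" if "i \<in> pos_indices n A d e" for i
    using that by (auto simp: pos_indices_def zero_extended_def)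
  have S: "i \<in> {1..n}" "e i \<noteq> Minf" if "i \<in> zero_indices n e" for i
    using that by (auto simp: zero_indices_def zero_extended_def)
  have fin: "finite (pos_indices n A d e)" "finite (zero_indices n e)"
    by (auto simp: pos_indices_def zero_indices_def)
  have "poly_vs.subspace (direction_space n A d e)"
    by (simp add: direction_space_def poly_vs.subspace_single_0)
  moreover have "direction_space n A d e \<subseteq> polys_upto d"
    using fin R by (auto simp: direction_space_eq[OF e] polys_upto_def intro!: degree_sum_le le)
  \<comment> \<open>At a zero entry the summand A_i is read as 1 * A_i, so that \<open>le\<close>
    applies with p = 1.\<close>
  moreover have "base_point n A d e \<in> polys_upto d"
    using fin R S le[of _ 1] unfolding polys_upto_def base_point_def
    by (auto intro!: degree_add_le degree_sum_le le simp: degree_monom_eq)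
  ultimately show ?thesis unfolding affine_subspace_upto_def by blast
qed

theorem theorem6p5:
  fixes A :: "nat \<Rightarrow> 'k::field poly" and n d :: nat
  assumes "n \<ge> 2"
    and "\<forall>i\<in>{1..n}. lead_coeff (A i) = 1"
    and "jointly_coprime n A"
    and "1 \<notin> A ` {1..n}"
    and "CHAR('k) = 0 \<or> CHAR('k) > n"
    and "d > 0"
    and "d \<ge> Min ((\<lambda>i. degree (A i)) ` {1..n})"
  shows "representable n A d =
           (\<Union>e\<in>degree_tuples n A d. base_point n A d e +o direction_space n A d e)
         \<and> (\<exists>\<X>. finite \<X> \<and> (\<forall>X\<in>\<X>. affine_subspace_upto d X)
                 \<and> representable n A d = \<Union>\<X>)"
proof -
  note eq = representable_eq_Union[OF assms(2,5,6)]
  let ?X = "(\<lambda>e. base_point n A d e +o direction_space n A d e) ` degree_tuples n A d"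
  have "finite ?X" by (simp add: finite_degree_tuples)
  moreover have "\<forall>X\<in>?X. affine_subspace_upto d X"
    by (auto intro: affine_subspace_upto_translate)
  ultimately show ?thesis using eq by blast
qed

end
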